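(* Let $n \geq 3$ be a positive integer, and let $A, B$ be symmetric $n \times n$ matrices over a field $K$ of characteristic zero. Let $(f_A, f_B)$ be the corresponding pair of $n$-ary quadratic forms. Then the pair $(A,B)$ can be simultaneously diagonalized over the splitting field $L$ of the binary form $$F_{(A,B)}(x,y) = \det(Ax - By) = \prod_{j=1}^n (s_j x - t_j y).$$ Moreover, up to permutation of columns there is a unique matrix $U$ defined over $L$ such that $(U^t A U, U^t B U)$ is a pair of diagonal matrices. The linear forms $U\mathbf{x}$, up to a scalar factor, are determined by the adjugates of the matrices $t_i A - s_i B$, $1 \leq i \leq n$.
   Context: For a symmetric matrix $M$, the associated quadratic form is $f_M(\mathbf{x}) = \mathbf{x}^t M\mathbf{x}$. The numbers $s_j, t_j$ are those appearing in the factorization of $F_{(A,B)}$ into linear forms displayed in the claim.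
   Formalization: The linear factors s_j x - t_j y are assumed pairwise non-proportional, U is required invertible, and U is unique up to permutation and nonzero scaling of columns; the linear forms are those with the columns of U as coefficients. Without distinct factors the claim fails (e.g. some F = -x^3). *)

theory Defs
  imports
    "Jordan_Normal_Form.Determinant"
    "HOL-Algebra.Algebraic_Closure_Type"
    "HOL-Combinatorics.Permutations"
begin

text \<open>
  The base field and its extensions are subfields of one ambient field \<open>'a\<close> of characteristic
  zero. This loses no generality: every field embeds in a field containing a given splitting field.
  Matrices have entries in \<open>'a\<close>, and "over \<open>F\<close>" means that all entries lie in \<open>F\<close>.
\<close>

definition mats_over :: "'a set \<Rightarrow> nat \<Rightarrow> 'a mat set" where
  "mats_over F n = {M \<in> carrier_mat n n. elements_mat M \<subseteq> F}"

definition vecs_over :: "'a set \<Rightarrow> nat \<Rightarrow> 'a vec set" where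
  "vecs_over F n = {v \<in> carrier_vec n. set\<^sub>v v \<subseteq> F}"

definition symmetric_matrix :: "'a mat \<Rightarrow> bool" where
  "symmetric_matrix M \<longleftrightarrow> transpose_mat M = M"

definition quadratic_form :: "'a::comm_ring_1 mat \<Rightarrow> 'a vec \<Rightarrow> 'a" where
  "quadratic_form M x = x \<bullet> (M *\<^sub>v x)"

text \<open>Forms are represented by the functions they induce on the ambient field; that field is
  infinite, so equality of functions is equality of forms.\<close>

definition pair_form :: "'a::comm_ring_1 mat \<Rightarrow> 'a mat \<Rightarrow> 'a \<Rightarrow> 'a \<Rightarrow> 'a" where
  "pair_form A B x y = det (x \<cdot>\<^sub>m A - y \<cdot>\<^sub>m B)"

definition linear_factorization ::
  "nat \<Rightarrow> ('a::comm_ring_1 \<Rightarrow> 'a \<Rightarrow> 'a) \<Rightarrow> (nat \<Rightarrow> 'a) \<Rightarrow> (nat \<Rightarrow> 'a) \<Rightarrow> bool" where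
  "linear_factorization n F s t \<longleftrightarrow> (\<forall>x y. F x y = (\<Prod>j<n. s j * x - t j * y))"

definition splits_over :: "nat \<Rightarrow> ('a::comm_ring_1 \<Rightarrow> 'a \<Rightarrow> 'a) \<Rightarrow> 'a set \<Rightarrow> bool" where
  "splits_over n F L \<longleftrightarrow>
     (\<exists>s t. (\<forall>j<n. s j \<in> L \<and> t j \<in> L) \<and> linear_factorization n F s t)"

definition is_splitting_field ::
  "nat \<Rightarrow> ('a::field \<Rightarrow> 'a \<Rightarrow> 'a) \<Rightarrow> 'a set \<Rightarrow> 'a set \<Rightarrow> bool" where
  "is_splitting_field n F K L \<longleftrightarrow>
     subfield L ring_of_type_algebra \<and> K \<subseteq> L \<and> splits_over n F L \<and>
     (\<forall>L'. subfield L' ring_of_type_algebra \<and> K \<subseteq> L' \<and> L' \<subseteq> L \<and> splits_over n F L'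
        \<longrightarrow> L' = L)"

text \<open>Invertibility is part of simultaneous diagonalization (otherwise \<open>U = 0\<close> would qualify). The
  inverse of \<open>U\<close> automatically has entries in \<open>L\<close> when \<open>L\<close> is a field.\<close>

definition diagonalizes_over ::
  "'a::comm_ring_1 set \<Rightarrow> nat \<Rightarrow> 'a mat \<Rightarrow> 'a mat \<Rightarrow> 'a mat \<Rightarrow> bool" where
  "diagonalizes_over L n A B U \<longleftrightarrow>
     U \<in> mats_over L n \<and> invertible_mat U \<and>
     diagonal_mat (transpose_mat U * A * U) \<and> diagonal_mat (transpose_mat U * B * U)"

text \<open>Columns can always be rescaled without leaving the set of diagonalizing matrices, so uniqueness
  is up to permutation and nonzero scaling of columns.\<close>

definition same_columns_upto_perm_scale ::
  "'a::comm_ring_1 set \<Rightarrow> nat \<Rightarrow> 'a mat \<Rightarrow> 'a mat \<Rightarrow> bool" where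
  "same_columns_upto_perm_scale L n U V \<longleftrightarrow>
     (\<exists>\<pi>. \<pi> permutes {..<n} \<and>
        (\<forall>j<n. \<exists>d\<in>L. d \<noteq> 0 \<and> col V (\<pi> j) = d \<cdot>\<^sub>v col U j))"

text \<open>The linear form with coefficient vector \<open>w\<close> is \<open>x \<mapsto> w \<bullet> x\<close>. The forms attached to \<open>U\<close> are those
  whose coefficient vectors are its columns. A linear form is determined by a matrix \<open>M\<close> if its
  square is proportional to the quadratic form of \<open>M\<close>; the following says that, up to a nonzero
  scalar, \<open>u\<close> is the one and only such form over \<open>L\<close>.\<close>

definition determines_linear_form ::
  "'a::comm_ring_1 set \<Rightarrow> nat \<Rightarrow> 'a mat \<Rightarrow> 'a vec \<Rightarrow> bool" where
  "determines_linear_form L n M u \<longleftrightarrow>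
     (\<forall>w\<in>vecs_over L n.
        (\<exists>c\<in>L. c \<noteq> 0 \<and> (\<forall>x\<in>carrier_vec n. quadratic_form M x = c * (w \<bullet> x)\<^sup>2))
        \<longleftrightarrow> (\<exists>d\<in>L. d \<noteq> 0 \<and> w = d \<cdot>\<^sub>v u))"

end

theory Submission
  imports Defs
begin

text \<open>Fix a nonsingular member \<open>P\<close> of the pencil. A kernel vector \<open>v j\<close> of \<open>t j A - s j B\<close>
  satisfies \<open>(t i A - s i B) v j = r i j (P v j)\<close> with a scalar \<open>r i j\<close> vanishing only for
  \<open>i = j\<close>, because the roots are distinct. Hence each \<open>t i A - s i B\<close> removes exactly one term from a linear
  combination of the \<open>v j\<close>; this makes the \<open>v j\<close> a basis and each kernel one-dimensional.
  Kernel vectors for different roots are orthogonal for \<open>A\<close> and \<open>B\<close>, so they are the columns of a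
  diagonalizing matrix. Conversely, the columns of any diagonalizing matrix lie in these kernels, which
  gives uniqueness. The adjugate of a symmetric matrix whose kernel is the line through
  \<open>u\<close> is a nonzero multiple of \<open>u u\<^sup>t\<close>: it determines \<open>u\<close> up to a scalar, and since its entries
  lie in \<open>L\<close>, so do those of a suitable multiple of \<open>u\<close>.\<close>

no_notation fps_nth (infixl \<open>$\<close> 75)

section \<open>Entries in a subfield\<close>

text \<open>Bridge between \<open>subfield\<close>, phrased with record operations, and the type
  class operations used on matrix entries.\<close>

lemma subfield_ring_of_type_algebraD:
  fixes L :: "'a::field set"
  assumes "subfield L ring_of_type_algebra"
  shows "0 \<in> L" and "1 \<in> L"
    and "x \<in> L \<Longrightarrow> y \<in> L \<Longrightarrow> x + y \<in> L"
    and "x \<in> L \<Longrightarrow> y \<in> L \<Longrightarrow> x * y \<in> L"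
    and "x \<in> L \<Longrightarrow> - x \<in> L"
    and "x \<in> L \<Longrightarrow> y \<in> L \<Longrightarrow> x - y \<in> L"
    and "x \<in> L \<Longrightarrow> y \<in> L \<Longrightarrow> x / y \<in> L"
proof -
  let ?R = "ring_of_type_algebra :: 'a ring"
  interpret R: Ring.field ?R by (rule field_from_type_algebra)
  note sub = subringE[OF subfieldE(1)[OF assms]]
  have ops: "\<zero>\<^bsub>?R\<^esub> = 0" "\<one>\<^bsub>?R\<^esub> = 1" "a \<oplus>\<^bsub>?R\<^esub> b = a + b" "a \<otimes>\<^bsub>?R\<^esub> b = a * b" for a b
    by (simp_all add: ring_of_type_algebra_def)
  have neg: "\<ominus>\<^bsub>?R\<^esub> a = - a" for a
  proof -
    have "a + \<ominus>\<^bsub>?R\<^esub> a = 0"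
      using R.r_neg[of a] by (simp add: ring_of_type_algebra_def)
    then show ?thesis
      by (simp add: minus_unique)
  qed
  \<comment> \<open>The case \<open>a = 0\<close> rests on the default \<open>inverse 0 = 0\<close>,
    so closure under \<open>/\<close> holds for every denominator in \<open>L\<close>.\<close>
  have inv: "inverse a \<in> L" if "a \<in> L" for a
  proof (cases "a = 0")
    case False
    then have "a \<in> L - {\<zero>\<^bsub>?R\<^esub>}"
      using that by (simp add: ops)
    from R.subfield_m_inv(1,2)[OF assms this] show ?thesis
      by (metis DiffD1 inverse_unique ops(2) ops(4))
  qed (use that in auto)
  show 0: "0 \<in> L" and 1: "1 \<in> L"
    using sub(2,3) by (simp_all add: ops)
  show add: "x + y \<in> L" if "x \<in> L" "y \<in> L" for x y
    using sub(7)[OF that] by (simp add: ops)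
  show mult: "x * y \<in> L" if "x \<in> L" "y \<in> L" for x y
    using sub(6)[OF that] by (simp add: ops)
  show uminus: "- x \<in> L" if "x \<in> L" for x
    using sub(5)[OF that] by (simp add: neg)
  show "x - y \<in> L" if "x \<in> L" "y \<in> L" for x y
    using add[OF that(1) uminus[OF that(2)]] by simp
  show "x / y \<in> L" if "x \<in> L" "y \<in> L" for x y
    using mult[OF that(1) inv[OF that(2)]] by (simp add: divide_inverse)
qed

lemma mats_over_iff:
  "M \<in> mats_over F n \<longleftrightarrow> M \<in> carrier_mat n n \<and> (\<forall>i<n. \<forall>j<n. M $$ (i, j) \<in> F)"
  unfolding mats_over_def by (fastforce dest: elements_matD)

lemma vecs_over_iff:
  "v \<in> vecs_over F n \<longleftrightarrow> v \<in> carrier_vec n \<and> (\<forall>i<n. v $ i \<in> F)"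
  unfolding vecs_over_def by (fastforce simp: vec_set_def)

text \<open>By the Leibniz formula, the determinant is a signed sum of products of entries.\<close>

lemma det_in_subfield:
  fixes L :: "'a::field set"
  assumes L: "subfield L ring_of_type_algebra" and M: "M \<in> mats_over L n"
  shows "det M \<in> L"
proof -
  note L_closed = subfield_ring_of_type_algebraD[OF L]
  have sum: "sum f S \<in> L" if "\<And>x. x \<in> S \<Longrightarrow> f x \<in> L" for f :: "(nat \<Rightarrow> nat) \<Rightarrow> 'a" and S
    using that by (induction S rule: infinite_finite_induct) (auto intro: L_closed)
  have prod: "prod f S \<in> L" if "\<And>x. x \<in> S \<Longrightarrow> f x \<in> L" for f :: "nat \<Rightarrow> 'a" and S
    using that by (induction S rule: infinite_finite_induct) (auto intro: L_closed)
  have "signof p * (\<Prod>i = 0..<n. M $$ (i, p i)) \<in> L" if "p permutes {0..<n}" for p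
  proof -
    have "M $$ (i, p i) \<in> L" if "i \<in> {0..<n}" for i
      using M \<open>p permutes {0..<n}\<close> that permutes_in_image[of p "{0..<n}" i]
      by (auto simp: mats_over_iff)
    then have "(\<Prod>i = 0..<n. M $$ (i, p i)) \<in> L"
      by (rule prod)
    then show ?thesis
      using L_closed by (auto simp: sign_def)
  qed
  then show ?thesis
    using M unfolding mats_over_iff by (auto simp: det_def' intro!: sum)
qed

lemma adj_mat_in_subfield:
  fixes L :: "'a::field set"
  assumes L: "subfield L ring_of_type_algebra" and M: "M \<in> mats_over L n"
  shows "adj_mat M \<in> mats_over L n"
proof -
  note L_closed = subfield_ring_of_type_algebraD[OF L]
  have "cofactor M i j \<in> L" if "i < n" "j < n" for i j
  proof -
    have "mat_delete M i j \<in> mats_over L (n - 1)"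
      using M that by (auto simp: mats_over_iff mat_delete_def)
    then have "det (mat_delete M i j) \<in> L"
      by (rule det_in_subfield[OF L])
    moreover have "(- 1) ^ k \<in> L" for k
      by (induction k) (auto intro: L_closed)
    ultimately show ?thesis
      unfolding cofactor_def by (rule L_closed(4)[rotated])
  qed
  then show ?thesis
    using M by (auto simp: mats_over_iff adj_mat_def)
qed

section \<open>Symmetric matrices with a one-dimensional kernel\<close>

lemma invertible_mat_iff_det_nonzero:
  fixes U :: "'a::field mat"
  assumes U: "U \<in> carrier_mat n n"
  shows "invertible_mat U \<longleftrightarrow> det U \<noteq> 0"
proof
  assume "invertible_mat U"
  then obtain W where UW: "U * W = 1\<^sub>m n" and WU: "W * U = 1\<^sub>m (dim_row W)"
    using U unfolding invertible_mat_def inverts_mat_def by auto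
  \<comment> \<open>The shape of \<open>W\<close> is not part of \<open>invertible_mat\<close>;
    comparing column counts in both product equations shows that it is square.\<close>
  have "W \<in> carrier_mat n n"
    using arg_cong[OF UW, of dim_col] arg_cong[OF WU, of dim_col] U by auto
  then have "det U * det W = 1"
    using UW U det_mult[of U n W] by simp
  then show "det U \<noteq> 0"
    by auto
next
  assume "det U \<noteq> 0"
  from det_non_zero_imp_unit[OF U this] obtain W
    where "W \<in> carrier_mat n n" "W * U = 1\<^sub>m n" "U * W = 1\<^sub>m n"
    unfolding Units_def ring_mat_def by auto
  then show "invertible_mat U"
    using U unfolding invertible_mat_def inverts_mat_def by auto
qed

lemma symmetric_scalar_prod_commute:
  fixes M :: "'a::comm_ring_1 mat"
  assumes "M \<in> carrier_mat n n" "symmetric_matrix M" "x \<in> carrier_vec n" "y \<in> carrier_vec n"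
  shows "x \<bullet> (M *\<^sub>v y) = y \<bullet> (M *\<^sub>v x)"
proof -
  have "x \<bullet> (M *\<^sub>v y) = (M *\<^sub>v x) \<bullet> y"
    using transpose_vec_mult_scalar[of M n n y x] assms by (simp add: symmetric_matrix_def)
  also have "\<dots> = y \<bullet> (M *\<^sub>v x)"
    using assms by (intro comm_scalar_prod) auto
  finally show ?thesis .
qed

text \<open>The diagonal cofactor at an index \<open>k\<close> with \<open>u $ k \<noteq> 0\<close> is the determinant of \<open>M\<close> with its
  \<open>k\<close>-th column replaced by the unit vector. That matrix is injective, because the range of \<open>M\<close> is
  orthogonal to \<open>u\<close> and the unit vector is not.\<close>

lemma cofactor_nonzero_of_kernel_line:
  fixes M :: "'a::field mat"
  assumes M: "M \<in> carrier_mat n n" and sym: "symmetric_matrix M"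
    and u: "u \<in> carrier_vec n" "M *\<^sub>v u = 0\<^sub>v n" and k: "k < n" "u $ k \<noteq> 0"
    and line: "\<And>x. x \<in> carrier_vec n \<Longrightarrow> M *\<^sub>v x = 0\<^sub>v n \<Longrightarrow> \<exists>d. x = d \<cdot>\<^sub>v u"
  shows "cofactor M k k \<noteq> 0"
proof -
  define M' where "M' = mat n n (\<lambda>(i, j). if j = k then (if i = k then 1 else 0) else M $$ (i, j))"
  have M': "M' \<in> carrier_mat n n"
    by (simp add: M'_def)
  have "det M' = (\<Sum>i<n. M' $$ (i, k) * cofactor M' i k)"
    by (rule laplace_expansion_column[OF M' k(1)])
  also have "\<dots> = (\<Sum>i<n. if i = k then cofactor M' i k else 0)"
    using k by (intro sum.cong) (auto simp: M'_def)
  also have "\<dots> = cofactor M' k k"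
    using k by simp
  also have "mat_delete M' k k = mat_delete M k k"
    using M k by (auto simp: M'_def mat_delete_def intro!: eq_matI)
  then have "cofactor M' k k = cofactor M k k"
    by (simp add: cofactor_def)
  finally have det: "det M' = cofactor M k k" .
  have "x = 0\<^sub>v n" if x: "x \<in> carrier_vec n" and 0: "M' *\<^sub>v x = 0\<^sub>v n" for x
  proof -
    \<comment> \<open>\<open>y\<close> is \<open>x\<close> with coordinate \<open>k\<close> cleared,
      so \<open>M' *\<^sub>v x\<close> splits as \<open>M *\<^sub>v y\<close> plus
      \<open>x $ k\<close> times the unit vector.\<close>
    define y where "y = vec n (\<lambda>j. if j = k then 0 else x $ j)"
    have y: "y \<in> carrier_vec n"
      by (simp add: y_def)
    have split: "M *\<^sub>v y = - x $ k \<cdot>\<^sub>v unit_vec n k"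
    proof (rule eq_vecI)
      fix i assume "i < dim_vec (- x $ k \<cdot>\<^sub>v unit_vec n k)"
      then have i: "i < n" by simp
      have "(M' *\<^sub>v x) $ i = (\<Sum>j<n. M' $$ (i, j) * x $ j)"
        using M' x i by (auto simp: scalar_prod_def atLeast0LessThan)
      also have "\<dots> = (\<Sum>j<n. M $$ (i, j) * y $ j + (if j = k then (if i = k then x $ k else 0) else 0))"
        using i by (intro sum.cong) (auto simp: M'_def y_def)
      also have "\<dots> = (\<Sum>j<n. M $$ (i, j) * y $ j) + (if i = k then x $ k else 0)"
        using k by (simp add: sum.distrib)
      also have "(\<Sum>j<n. M $$ (i, j) * y $ j) = (M *\<^sub>v y) $ i"
        using M y i by (auto simp: scalar_prod_def atLeast0LessThan)
      finally have "(M *\<^sub>v y) $ i + (if i = k then x $ k else 0) = 0"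
        using 0 i by simp
      then show "(M *\<^sub>v y) $ i = (- x $ k \<cdot>\<^sub>v unit_vec n k) $ i"
        using i k by (auto simp: add_eq_0_iff2 unit_vec_def)
    qed (use M in auto)
    have "u \<bullet> (M *\<^sub>v y) = 0"
      using symmetric_scalar_prod_commute[OF M sym u(1) y] u y by simp
    then have xk: "x $ k = 0"
      using k u by (simp add: split)
    then have "y = x"
      using x by (auto simp: y_def)
    with split xk have "M *\<^sub>v x = 0\<^sub>v n"
      by (auto simp: unit_vec_def)
    then obtain d where "x = d \<cdot>\<^sub>v u"
      using line x by blast
    then show ?thesis
      using xk k u by auto
  qed
  then have "det M' \<noteq> 0"
    using det_0_iff_vec_prod_zero[OF M'] by auto
  then show ?thesis
    by (simp add: det)
qed

text \<open>Since \<open>det M = 0\<close>, both products of \<open>M\<close> with its adjugate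
  vanish. So the columns of the adjugate and, by symmetry of \<open>M\<close>, its rows lie on the
  kernel line, which forces a multiple of u u^t. The diagonal cofactor at \<open>k\<close> makes the
  multiple nonzero.\<close>

lemma adj_mat_of_kernel_line:
  fixes M :: "'a::field mat"
  assumes M: "M \<in> carrier_mat n n" and sym: "symmetric_matrix M"
    and u: "u \<in> carrier_vec n" "u \<noteq> 0\<^sub>v n" "M *\<^sub>v u = 0\<^sub>v n"
    and line: "\<And>x. x \<in> carrier_vec n \<Longrightarrow> M *\<^sub>v x = 0\<^sub>v n \<Longrightarrow> \<exists>d. x = d \<cdot>\<^sub>v u"
  shows "\<exists>c. c \<noteq> 0 \<and> (\<forall>i<n. \<forall>j<n. adj_mat M $$ (i, j) = c * u $ i * u $ j)"
proof -
  obtain k where k: "k < n" "u $ k \<noteq> 0"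
    using u by (metis carrier_vecD eq_vecI index_zero_vec)
  have "det M = 0"
    using det_0_iff_vec_prod_zero[OF M] u by blast
  then have prods: "M * adj_mat M = 0\<^sub>m n n" "adj_mat M * M = 0\<^sub>m n n"
    using adj_mat[OF M] by auto
  note carrier = adj_mat(1)[OF M]
  have sym_entry: "M $$ (i, j) = M $$ (j, i)" if "i < n" "j < n" for i j
    using that M sym unfolding symmetric_matrix_def
    by (metis carrier_matD index_transpose_mat(1))
  have "\<exists>d. col (adj_mat M) j = d \<cdot>\<^sub>v u" if "j < n" for j
    using that carrier M col_mult2[OF M carrier that] prods by (intro line) auto
  then obtain a where a: "\<And>j. j < n \<Longrightarrow> col (adj_mat M) j = a j \<cdot>\<^sub>v u"
    by metis
  have "\<exists>d. row (adj_mat M) i = d \<cdot>\<^sub>v u" if i: "i < n" for i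
  proof (rule line)
    show "M *\<^sub>v row (adj_mat M) i = 0\<^sub>v n"
    proof (rule eq_vecI)
      fix j assume "j < dim_vec (0\<^sub>v n :: 'a vec)"
      then have j: "j < n" by simp
      have "row M j = col M j"
        using M j sym_entry by (intro eq_vecI) auto
      then have "(M *\<^sub>v row (adj_mat M) i) $ j = col M j \<bullet> row (adj_mat M) i"
        using M j by simp
      also have "\<dots> = row (adj_mat M) i \<bullet> col M j"
        using M carrier i j by (intro comm_scalar_prod[of _ n]) auto
      also have "\<dots> = (adj_mat M * M) $$ (i, j)"
        using M carrier i j by simp
      finally show "(M *\<^sub>v row (adj_mat M) i) $ j = 0\<^sub>v n $ j"
        using prods i j by simp
    qed (use M in auto)
  qed (use carrier i in auto)
  then obtain b where b: "\<And>i. i < n \<Longrightarrow> row (adj_mat M) i = b i \<cdot>\<^sub>v u"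
    by metis
  have a': "adj_mat M $$ (i, j) = a j * u $ i" if "i < n" "j < n" for i j
    using arg_cong[OF a[OF that(2)], of "\<lambda>v. v $ i"] that carrier u(1) by simp
  have b': "adj_mat M $$ (i, j) = b i * u $ j" if "i < n" "j < n" for i j
    using arg_cong[OF b[OF that(1)], of "\<lambda>v. v $ j"] that carrier u(1) by simp
  \<comment> \<open>Entry \<open>(k, j)\<close> of the adjugate is \<open>a j * u $ k\<close> by
    columns and \<open>b k * u $ j\<close> by rows; solving for \<open>a j\<close> gives this
    constant.\<close>
  define c where "c = b k / u $ k"
  have "a j = c * u $ j" if "j < n" for j
    using a'[OF k(1) that] b'[OF k(1) that] k by (simp add: c_def field_simps)
  then have adj: "adj_mat M $$ (i, j) = c * u $ i * u $ j" if "i < n" "j < n" for i j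
    using a' that by (simp add: mult_ac)
  have "adj_mat M $$ (k, k) \<noteq> 0"
    using cofactor_nonzero_of_kernel_line[OF M sym u(1,3) k line] k M by (simp add: adj_mat_def)
  then have "c \<noteq> 0"
    using adj k by auto
  with adj show ?thesis
    by blast
qed

section \<open>Linear forms and their squares\<close>

lemma quadratic_form_rank_one:
  fixes M :: "'a::comm_ring_1 mat"
  assumes M: "M \<in> carrier_mat n n" and u: "u \<in> carrier_vec n" and x: "x \<in> carrier_vec n"
    and entries: "\<And>i j. i < n \<Longrightarrow> j < n \<Longrightarrow> M $$ (i, j) = c * u $ i * u $ j"
  shows "quadratic_form M x = c * (u \<bullet> x)\<^sup>2"
proof -
  have "M *\<^sub>v x = (c * (u \<bullet> x)) \<cdot>\<^sub>v u"
    using M u x entries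
    by (intro eq_vecI) (auto simp: scalar_prod_def sum_distrib_left sum_distrib_right mult_ac
        intro!: sum.cong)
  then show ?thesis
    using u x comm_scalar_prod[of x n u] by (simp add: quadratic_form_def power2_eq_square mult_ac)
qed

text \<open>The coefficients of a linear form are recovered from its square by polarization.\<close>

lemma linear_form_unique_of_square:
  fixes u w :: "'a::field_char_0 vec"
  assumes u: "u \<in> carrier_vec n" "u \<noteq> 0\<^sub>v n" and w: "w \<in> carrier_vec n"
    and c: "c \<noteq> 0" and c': "c' \<noteq> 0"
    and eq: "\<And>x. x \<in> carrier_vec n \<Longrightarrow> c * (u \<bullet> x)\<^sup>2 = c' * (w \<bullet> x)\<^sup>2"
  shows "\<exists>d. d \<noteq> 0 \<and> w = d \<cdot>\<^sub>v u"
proof -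
  obtain k where k: "k < n" "u $ k \<noteq> 0"
    using u by (metis carrier_vecD eq_vecI index_zero_vec)
  have sq: "c * (u $ i)\<^sup>2 = c' * (w $ i)\<^sup>2" if "i < n" for i
    using eq[of "unit_vec n i"] that by simp
  have polar: "c * (u $ i * u $ j) = c' * (w $ i * w $ j)" if "i < n" "j < n" for i j
  proof -
    \<comment> \<open>Evaluating at a sum of two unit vectors and removing the two squares leaves
      twice the mixed product; 2 cancels in characteristic zero.\<close>
    have "c * (u $ i + u $ j)\<^sup>2 = c' * (w $ i + w $ j)\<^sup>2"
      using eq[of "unit_vec n i + unit_vec n j"] that u w
      by (simp add: scalar_prod_add_distrib[of _ n])
    then have "c * (u $ i)\<^sup>2 + c * (u $ j)\<^sup>2 + 2 * (c * (u $ i * u $ j))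
        = c' * (w $ i)\<^sup>2 + c' * (w $ j)\<^sup>2 + 2 * (c' * (w $ i * w $ j))"
      by (simp add: power2_eq_square algebra_simps)
    then have "2 * (c * (u $ i * u $ j)) = 2 * (c' * (w $ i * w $ j))"
      by (simp only: sq[OF that(1)] sq[OF that(2)] add_left_cancel)
    then show ?thesis
      by simp
  qed
  have wk: "w $ k \<noteq> 0"
    using sq[OF k(1)] k c c' by auto
  \<comment> \<open>The factor comes from solving the polarized identity at \<open>(k, j)\<close>
    for \<open>w $ j\<close>.\<close>
  have "w = (c * u $ k / (c' * w $ k)) \<cdot>\<^sub>v u"
  proof (rule eq_vecI)
    fix j assume "j < dim_vec ((c * u $ k / (c' * w $ k)) \<cdot>\<^sub>v u)"
    then show "w $ j = ((c * u $ k / (c' * w $ k)) \<cdot>\<^sub>v u) $ j"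
      using polar[OF k(1), of j] wk c' u by (simp add: field_simps)
  qed (use u w in auto)
  then show ?thesis
    using k c c' wk by (metis divide_eq_0_iff mult_eq_0_iff)
qed

text \<open>Proportionality factors first arise in the ambient field; as a quotient of two
  coordinates they lie in \<open>L\<close>.\<close>

lemma smult_coeff_in_subfield:
  fixes L :: "'a::field set"
  assumes L: "subfield L ring_of_type_algebra"
    and "u \<in> vecs_over L n" "u \<noteq> 0\<^sub>v n" "d \<cdot>\<^sub>v u \<in> vecs_over L n"
  shows "d \<in> L"
proof -
  obtain k where k: "k < n" "u $ k \<noteq> 0"
    using assms(2,3) by (metis carrier_vecD eq_vecI index_zero_vec vecs_over_iff)
  then have "d = (d \<cdot>\<^sub>v u) $ k / u $ k"
    using assms(2) by (auto simp: vecs_over_iff)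
  then show ?thesis
    using assms k by (metis subfield_ring_of_type_algebraD(7) vecs_over_iff)
qed

text \<open>The adjugate has the quadratic form \<open>c * (u \<bullet> x)\<^sup>2\<close>.
  Polarization makes any other such form a multiple of \<open>u\<close>, and rescaling
  \<open>u\<close> by \<open>d\<close> merely changes \<open>c\<close> to
  \<open>c / d / d\<close>.\<close>

lemma adj_mat_determines_kernel_line:
  fixes M :: "'a::field_char_0 mat"
  assumes L: "subfield L ring_of_type_algebra"
    and M: "M \<in> mats_over L n" and sym: "symmetric_matrix M"
    and u: "u \<in> vecs_over L n" "u \<noteq> 0\<^sub>v n" "M *\<^sub>v u = 0\<^sub>v n"
    and line: "\<And>x. x \<in> carrier_vec n \<Longrightarrow> M *\<^sub>v x = 0\<^sub>v n \<Longrightarrow> \<exists>d. x = d \<cdot>\<^sub>v u"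
  shows "determines_linear_form L n (adj_mat M) u"
proof -
  have carrier: "M \<in> carrier_mat n n" "u \<in> carrier_vec n"
    using M u by (auto simp: mats_over_iff vecs_over_iff)
  obtain c where c: "c \<noteq> 0" "\<And>i j. i < n \<Longrightarrow> j < n \<Longrightarrow> adj_mat M $$ (i, j) = c * u $ i * u $ j"
    using adj_mat_of_kernel_line[OF carrier(1) sym carrier(2) u(2,3) line] by blast
  have form: "quadratic_form (adj_mat M) x = c * (u \<bullet> x)\<^sup>2" if "x \<in> carrier_vec n" for x
    by (rule quadratic_form_rank_one[OF adj_mat(1)[OF carrier(1)] carrier(2) that c(2)])
  obtain k where k: "k < n" "u $ k \<noteq> 0"
    using u carrier by (metis carrier_vecD eq_vecI index_zero_vec)
  \<comment> \<open>A diagonal entry exhibits \<open>c\<close> as a quotient of elements of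
    \<open>L\<close>.\<close>
  have "c = adj_mat M $$ (k, k) / u $ k / u $ k"
    using c k by simp
  then have cL: "c \<in> L"
    using adj_mat_in_subfield[OF L M] u k subfield_ring_of_type_algebraD(7)[OF L]
    by (metis mats_over_iff vecs_over_iff)
  show ?thesis
    unfolding determines_linear_form_def
  proof (intro ballI iffI)
    fix w assume w: "w \<in> vecs_over L n"
    assume "\<exists>c'\<in>L. c' \<noteq> 0 \<and> (\<forall>x\<in>carrier_vec n. quadratic_form (adj_mat M) x = c' * (w \<bullet> x)\<^sup>2)"
    then obtain c' where "c' \<noteq> 0" "\<And>x. x \<in> carrier_vec n \<Longrightarrow> c * (u \<bullet> x)\<^sup>2 = c' * (w \<bullet> x)\<^sup>2"
      using form by auto
    then obtain d where d: "d \<noteq> 0" "w = d \<cdot>\<^sub>v u"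
      using linear_form_unique_of_square[OF carrier(2) u(2) _ c(1)] w
      by (metis vecs_over_iff)
    then have "d \<in> L"
      using smult_coeff_in_subfield[OF L u(1,2)] w by blast
    with d show "\<exists>d\<in>L. d \<noteq> 0 \<and> w = d \<cdot>\<^sub>v u"
      by blast
  next
    fix w assume "w \<in> vecs_over L n" "\<exists>d\<in>L. d \<noteq> 0 \<and> w = d \<cdot>\<^sub>v u"
    then obtain d where d: "d \<in> L" "d \<noteq> 0" "w = d \<cdot>\<^sub>v u"
      by blast
    have "quadratic_form (adj_mat M) x = c / d / d * (w \<bullet> x)\<^sup>2" if "x \<in> carrier_vec n" for x
      using that d carrier form by (simp add: power2_eq_square)
    moreover have "c / d / d \<in> L"
      using d cL by (intro subfield_ring_of_type_algebraD(7)[OF L])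
    moreover have "c / d / d \<noteq> 0"
      using d c by simp
    ultimately show "\<exists>c\<in>L. c \<noteq> 0 \<and> (\<forall>x\<in>carrier_vec n. quadratic_form (adj_mat M) x = c * (w \<bullet> x)\<^sup>2)"
      by blast
  qed
qed

section \<open>Symmetric pencils with distinct roots\<close>

text \<open>Moves column factors into the coefficient vector; this extends the action of a singular
  member from single kernel vectors to their linear combinations.\<close>

lemma mult_mat_vec_scaled_cols:
  fixes P Q :: "'a::comm_ring_1 mat"
  assumes P: "P \<in> carrier_mat m n" and Q: "Q \<in> carrier_mat m n" and x: "x \<in> carrier_vec n"
    and cols: "\<And>j. j < n \<Longrightarrow> col P j = c j \<cdot>\<^sub>v col Q j"
  shows "P *\<^sub>v x = Q *\<^sub>v vec n (\<lambda>j. c j * x $ j)"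
proof (rule eq_vecI)
  fix i assume "i < dim_vec (Q *\<^sub>v vec n (\<lambda>j. c j * x $ j))"
  then have i: "i < m"
    using Q by simp
  have "P $$ (i, j) = c j * Q $$ (i, j)" if "j < n" for j
    using arg_cong[OF cols[OF that], of "\<lambda>v. v $ i"] i that P Q by simp
  then show "(P *\<^sub>v x) $ i = (Q *\<^sub>v vec n (\<lambda>j. c j * x $ j)) $ i"
    using P Q x i by (auto simp: scalar_prod_def mult_ac intro!: sum.cong)
qed (use P Q in auto)

lemma mult_mat_vec_single_support:
  fixes V :: "'a::comm_ring_1 mat"
  assumes V: "V \<in> carrier_mat m n" and x: "x \<in> carrier_vec n" and i: "i < n"
    and supp: "\<And>j. j < n \<Longrightarrow> j \<noteq> i \<Longrightarrow> x $ j = 0"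
  shows "V *\<^sub>v x = x $ i \<cdot>\<^sub>v col V i"
proof (rule eq_vecI)
  fix r assume "r < dim_vec (x $ i \<cdot>\<^sub>v col V i)"
  then have r: "r < m"
    using V by simp
  have "(V *\<^sub>v x) $ r = (\<Sum>j = 0..<n. V $$ (r, j) * x $ j)"
    using V x r by (simp add: scalar_prod_def)
  also have "\<dots> = (\<Sum>j = 0..<n. if j = i then V $$ (r, j) * x $ j else 0)"
    using supp by (intro sum.cong) auto
  finally show "(V *\<^sub>v x) $ r = (x $ i \<cdot>\<^sub>v col V i) $ r"
    using V r i by (simp add: mult_ac)
qed (use V in auto)

lemma mult_mat_zero_vec:
  fixes M :: "'a::semiring_0 mat"
  assumes "M \<in> carrier_mat m n"
  shows "M *\<^sub>v 0\<^sub>v n = 0\<^sub>v m"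
  using assms by (intro eq_vecI) auto

lemma smult_mult_mat_vec:
  fixes M :: "'a::comm_ring_1 mat"
  assumes "M \<in> carrier_mat m n" "v \<in> carrier_vec n"
  shows "(k \<cdot>\<^sub>m M) *\<^sub>v v = k \<cdot>\<^sub>v (M *\<^sub>v v)"
  using assms by (intro eq_vecI) auto

text \<open>The roots are points (t_j : s_j) of the projective line, so distinctness is stated by
  cross products and one coordinate may be zero. The point \<open>(x0, y0)\<close> avoids all of
  them, which makes \<open>pencil x0 y0\<close> the nonsingular member \<open>P\<close>.\<close>

locale symmetric_pencil =
  fixes n :: nat and A B :: "'a::field mat" and s t :: "nat \<Rightarrow> 'a" and x0 y0 :: 'a
  assumes A: "A \<in> carrier_mat n n" and A_sym: "symmetric_matrix A"
    and B: "B \<in> carrier_mat n n" and B_sym: "symmetric_matrix B"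
    and factorization: "linear_factorization n (pair_form A B) s t"
    and distinct_roots: "\<And>i j. i < n \<Longrightarrow> j < n \<Longrightarrow> i \<noteq> j \<Longrightarrow> s i * t j \<noteq> s j * t i"
    and regular: "\<And>j. j < n \<Longrightarrow> s j * x0 - t j * y0 \<noteq> 0"
begin

abbreviation pencil :: "'a \<Rightarrow> 'a \<Rightarrow> 'a mat" where
  "pencil x y \<equiv> x \<cdot>\<^sub>m A - y \<cdot>\<^sub>m B"

abbreviation singular :: "nat \<Rightarrow> 'a mat" where
  "singular i \<equiv> pencil (t i) (s i)"

lemma pencil_carrier [simp]: "pencil x y \<in> carrier_mat n n"
  using A B by (intro minus_carrier_mat smult_carrier_mat)

lemma pencil_mult_vec:
  assumes "v \<in> carrier_vec n"
  shows "pencil x y *\<^sub>v v = x \<cdot>\<^sub>v (A *\<^sub>v v) - y \<cdot>\<^sub>v (B *\<^sub>v v)"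
  using assms A B
  by (simp add: minus_mult_distrib_mat_vec[of _ n n] smult_mult_mat_vec[of _ n n])

lemma det_pencil: "det (pencil x y) = (\<Prod>j<n. s j * x - t j * y)"
  using factorization by (simp add: linear_factorization_def pair_form_def)

lemma pencil_symmetric: "symmetric_matrix (pencil x y)"
proof -
  have "transpose_mat (pencil x y) = x \<cdot>\<^sub>m transpose_mat A - y \<cdot>\<^sub>m transpose_mat B"
    using A B by (intro eq_matI) auto
  then show ?thesis
    using A_sym B_sym by (simp add: symmetric_matrix_def)
qed

lemma regular_kernel:
  assumes "v \<in> carrier_vec n" "pencil x0 y0 *\<^sub>v v = 0\<^sub>v n"
  shows "v = 0\<^sub>v n"
proof -
  have "det (pencil x0 y0) \<noteq> 0"
    using regular by (simp add: det_pencil)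
  then show ?thesis
    using det_0_iff_vec_prod_zero[OF pencil_carrier] assms by blast
qed

lemma singular_kernel_exists:
  assumes "i < n"
  shows "\<exists>v. v \<in> carrier_vec n \<and> v \<noteq> 0\<^sub>v n \<and> singular i *\<^sub>v v = 0\<^sub>v n"
proof -
  have "det (singular i) = 0"
    using assms by (auto simp: det_pencil intro!: bexI[of _ i])
  then show ?thesis
    using det_0_iff_vec_prod_zero[OF pencil_carrier] by blast
qed

lemma kernel_entries:
  assumes v: "v \<in> carrier_vec n" "singular j *\<^sub>v v = 0\<^sub>v n" and r: "r < n"
  shows "t j * (A *\<^sub>v v) $ r = s j * (B *\<^sub>v v) $ r"
  using arg_cong[OF v(2), of "\<lambda>w. w $ r"] v(1) r A B
  by (simp add: pencil_mult_vec del: index_mult_mat_vec)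

text \<open>On a kernel vector of \<open>singular j\<close>, \<open>pencil x y\<close> yields the
  \<open>j\<close>-th linear factor times a vector independent of \<open>x\<close> and
  \<open>y\<close>. This is the quotient of the values of that factor at \<open>(t i, s i)\<close>
  and at \<open>(x0, y0)\<close>.\<close>

definition ratio :: "nat \<Rightarrow> nat \<Rightarrow> 'a" where
  "ratio i j = (t i * s j - s i * t j) / (s j * x0 - t j * y0)"

lemma ratio_eq_0_iff:
  assumes "i < n" "j < n"
  shows "ratio i j = 0 \<longleftrightarrow> i = j"
  using assms distinct_roots[of i j] regular[of j]
  by (cases "i = j") (simp_all add: ratio_def mult_ac)

lemma singular_on_kernel:
  assumes v: "v \<in> carrier_vec n" "singular j *\<^sub>v v = 0\<^sub>v n" and j: "j < n"
  shows "singular i *\<^sub>v v = ratio i j \<cdot>\<^sub>v (pencil x0 y0 *\<^sub>v v)"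
proof (rule eq_vecI)
  fix r assume "r < dim_vec (ratio i j \<cdot>\<^sub>v (pencil x0 y0 *\<^sub>v v))"
  then have r: "r < n"
    using B by simp
  define a b \<mu> where "a = (A *\<^sub>v v) $ r" and "b = (B *\<^sub>v v) $ r" and "\<mu> = s j * x0 - t j * y0"
  have "t j * a = s j * b"
    unfolding a_def b_def by (rule kernel_entries[OF v r])
  \<comment> \<open>The right side contains \<open>t j * a - s j * b\<close>, which is zero. The
    identity avoids dividing by \<open>s j\<close> or \<open>t j\<close>, either of which may
    vanish.\<close>
  moreover have "\<mu> * (t i * a - s i * b) - (t i * s j - s i * t j) * (x0 * a - y0 * b)
      = (t j * a - s j * b) * (s i * x0 - t i * y0)"
    by (simp add: \<mu>_def algebra_simps)
  ultimately have "\<mu> * (t i * a - s i * b) = (t i * s j - s i * t j) * (x0 * a - y0 * b)"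
    by simp
  moreover have "\<mu> \<noteq> 0"
    using regular[OF j] by (simp add: \<mu>_def)
  ultimately have "t i * a - s i * b = ratio i j * (x0 * a - y0 * b)"
    unfolding ratio_def \<mu>_def[symmetric] by (simp add: field_simps)
  moreover have "(pencil x y *\<^sub>v v) $ r = x * a - y * b" for x y
    using A B v(1) r by (simp add: pencil_mult_vec a_def b_def del: index_mult_mat_vec)
  ultimately show "(singular i *\<^sub>v v) $ r = (ratio i j \<cdot>\<^sub>v (pencil x0 y0 *\<^sub>v v)) $ r"
    using B r by (simp del: index_mult_mat_vec)
qed (use B in auto)

section \<open>Linear independence and one-dimensional kernels\<close>

lemma singular_on_combination:
  assumes V: "V \<in> carrier_mat n n" and x: "x \<in> carrier_vec n"
    and ker: "\<And>j. j < n \<Longrightarrow> singular j *\<^sub>v col V j = 0\<^sub>v n"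
  shows "singular i *\<^sub>v (V *\<^sub>v x) = pencil x0 y0 *\<^sub>v (V *\<^sub>v vec n (\<lambda>j. ratio i j * x $ j))"
proof -
  have "(singular i * V) *\<^sub>v x = (pencil x0 y0 * V) *\<^sub>v vec n (\<lambda>j. ratio i j * x $ j)"
  proof (rule mult_mat_vec_scaled_cols)
    show "col (singular i * V) j = ratio i j \<cdot>\<^sub>v col (pencil x0 y0 * V) j" if "j < n" for j
      using singular_on_kernel[OF _ ker[OF that] that] V that
      by (simp add: col_mult2[of _ n n _ n])
  qed (use V x in auto)
  then show ?thesis
    using V x by (simp add: assoc_mult_mat_vec[of _ n n _ n])
qed

text \<open>Induction on the number of nonzero coefficients: applying \<open>singular i\<close> to a
  relation and cancelling the regular member gives a relation that has lost exactly the term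
  \<open>i\<close>.\<close>

lemma kernel_vectors_independent:
  assumes V: "V \<in> carrier_mat n n"
    and ker: "\<And>j. j < n \<Longrightarrow> singular j *\<^sub>v col V j = 0\<^sub>v n"
    and nz: "\<And>j. j < n \<Longrightarrow> col V j \<noteq> 0\<^sub>v n"
    and "x \<in> carrier_vec n" "V *\<^sub>v x = 0\<^sub>v n"
  shows "x = 0\<^sub>v n"
  using assms(4,5)
proof (induction "card {j. j < n \<and> x $ j \<noteq> 0}" arbitrary: x rule: less_induct)
  case less
  show ?case
  proof (rule ccontr)
    assume "x \<noteq> 0\<^sub>v n"
    then obtain i where i: "i < n" "x $ i \<noteq> 0"
      using less.prems by (metis carrier_vecD eq_vecI index_zero_vec)
    define x' where "x' = vec n (\<lambda>j. ratio i j * x $ j)"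
    have x': "x' \<in> carrier_vec n"
      by (simp add: x'_def)
    have "pencil x0 y0 *\<^sub>v (V *\<^sub>v x') = 0\<^sub>v n"
      using singular_on_combination[OF V less.prems(1) ker, of i] less.prems(2)
        mult_mat_zero_vec[OF pencil_carrier]
      by (simp add: x'_def)
    then have "V *\<^sub>v x' = 0\<^sub>v n"
      by (rule regular_kernel[OF mult_mat_vec_carrier[OF V x']])
    moreover have "x' $ j \<noteq> 0 \<longleftrightarrow> j \<noteq> i \<and> x $ j \<noteq> 0" if "j < n" for j
      using ratio_eq_0_iff[OF i(1) that] that by (auto simp: x'_def)
    then have "{j. j < n \<and> x' $ j \<noteq> 0} \<subset> {j. j < n \<and> x $ j \<noteq> 0}"
      using i by blast
    then have "card {j. j < n \<and> x' $ j \<noteq> 0} < card {j. j < n \<and> x $ j \<noteq> 0}"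
      by (intro psubset_card_mono) auto
    ultimately have "x' = 0\<^sub>v n"
      using less.hyps x' by blast
    \<comment> \<open>The shorter relation is trivial, so only \<open>i\<close> carries a
      coefficient and the nonzero column \<open>i\<close> would have to vanish.\<close>
    then have "ratio i j * x $ j = 0" if "j < n" for j
      using that by (metis index_vec index_zero_vec(1) x'_def)
    then have "x $ j = 0" if "j < n" "j \<noteq> i" for j
      using that i by (auto simp: ratio_eq_0_iff)
    then have "x $ i \<cdot>\<^sub>v col V i = 0\<^sub>v n"
      using mult_mat_vec_single_support[OF V less.prems(1) i(1)] less.prems(2) by simp
    then have "col V i = 0\<^sub>v n"
      using i V by (auto simp: vec_eq_iff)
    then show False
      using nz i by blast
  qed
qed

lemma det_kernel_matrix_nonzero:
  assumes V: "V \<in> carrier_mat n n"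
    and ker: "\<And>j. j < n \<Longrightarrow> singular j *\<^sub>v col V j = 0\<^sub>v n"
    and nz: "\<And>j. j < n \<Longrightarrow> col V j \<noteq> 0\<^sub>v n"
  shows "det V \<noteq> 0"
  using det_0_iff_vec_prod_zero[OF V] kernel_vectors_independent[OF V ker nz] by blast

text \<open>Kernel vectors for the other roots complete \<open>v\<close> to a basis. With
  \<open>w\<close> expanded in it, \<open>singular i\<close> multiplies each coefficient
  \<open>j \<noteq> i\<close> by a nonzero ratio, so only the \<open>v\<close> term can be
  present.\<close>

lemma kernel_line:
  assumes i: "i < n"
    and v: "v \<in> carrier_vec n" "v \<noteq> 0\<^sub>v n" "singular i *\<^sub>v v = 0\<^sub>v n"
    and w: "w \<in> carrier_vec n" "singular i *\<^sub>v w = 0\<^sub>v n"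
  shows "\<exists>d. w = d \<cdot>\<^sub>v v"
proof -
  have "\<exists>v'. v' \<in> carrier_vec n \<and> v' \<noteq> 0\<^sub>v n \<and> singular j *\<^sub>v v' = 0\<^sub>v n \<and> (j = i \<longrightarrow> v' = v)"
    if "j < n" for j
    using singular_kernel_exists[OF that] v by (cases "j = i") auto
  then obtain f where f: "\<And>j. j < n \<Longrightarrow> f j \<in> carrier_vec n"
      "\<And>j. j < n \<Longrightarrow> f j \<noteq> 0\<^sub>v n" "\<And>j. j < n \<Longrightarrow> singular j *\<^sub>v f j = 0\<^sub>v n" "f i = v"
    using i by metis
  define V where "V = mat n n (\<lambda>(r, j). f j $ r)"
  have V: "V \<in> carrier_mat n n"
    by (simp add: V_def)
  have col: "col V j = f j" if "j < n" for j
    using f(1)[OF that] that by (intro eq_vecI) (auto simp: V_def)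
  have ker: "\<And>j. j < n \<Longrightarrow> singular j *\<^sub>v col V j = 0\<^sub>v n"
    and nz: "\<And>j. j < n \<Longrightarrow> col V j \<noteq> 0\<^sub>v n"
    using f by (simp_all add: col)
  from det_non_zero_imp_unit[OF V det_kernel_matrix_nonzero[OF V ker nz]]
  obtain W where W: "W \<in> carrier_mat n n" "V * W = 1\<^sub>m n"
    unfolding Units_def ring_mat_def by auto
  define x where "x = W *\<^sub>v w"
  have x: "x \<in> carrier_vec n"
    using W w by (simp add: x_def)
  have Vx: "V *\<^sub>v x = w"
    using V W w by (simp add: x_def assoc_mult_mat_vec[symmetric, of V n n W n])
  define x' where "x' = vec n (\<lambda>j. ratio i j * x $ j)"
  have x': "x' \<in> carrier_vec n"
    by (simp add: x'_def)
  have "pencil x0 y0 *\<^sub>v (V *\<^sub>v x') = 0\<^sub>v n"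
    using singular_on_combination[OF V x ker, of i] Vx w(2) by (simp add: x'_def)
  then have "V *\<^sub>v x' = 0\<^sub>v n"
    by (rule regular_kernel[OF mult_mat_vec_carrier[OF V x']])
  then have "x' = 0\<^sub>v n"
    using kernel_vectors_independent[OF V ker nz x'] by simp
  then have "ratio i j * x $ j = 0" if "j < n" for j
    using that by (metis index_vec index_zero_vec(1) x'_def)
  then have "x $ j = 0" if "j < n" "j \<noteq> i" for j
    using that i by (auto simp: ratio_eq_0_iff)
  then have "w = x $ i \<cdot>\<^sub>v v"
    using mult_mat_vec_single_support[OF V x i] Vx col[OF i] f(4) by simp
  then show ?thesis
    by blast
qed

text \<open>By symmetry of \<open>A\<close> and \<open>B\<close>, the two kernel equations become
  homogeneous linear equations in \<open>w \<bullet> (A *\<^sub>v v)\<close> and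
  \<open>w \<bullet> (B *\<^sub>v v)\<close>, whose determinant is nonzero for distinct
  roots.\<close>

lemma kernels_orthogonal:
  assumes ij: "i < n" "j < n" "i \<noteq> j"
    and v: "v \<in> carrier_vec n" "singular i *\<^sub>v v = 0\<^sub>v n"
    and w: "w \<in> carrier_vec n" "singular j *\<^sub>v w = 0\<^sub>v n"
  shows "w \<bullet> (A *\<^sub>v v) = 0" and "w \<bullet> (B *\<^sub>v v) = 0"
proof -
  have eigen: "t k * (z \<bullet> (A *\<^sub>v u)) = s k * (z \<bullet> (B *\<^sub>v u))"
    if "u \<in> carrier_vec n" "singular k *\<^sub>v u = 0\<^sub>v n" "z \<in> carrier_vec n" for u z k
  proof -
    have "t k \<cdot>\<^sub>v (A *\<^sub>v u) = s k \<cdot>\<^sub>v (B *\<^sub>v u)"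
      using kernel_entries[OF that(1,2)] A B
      by (intro eq_vecI) (simp_all del: index_mult_mat_vec)
    from arg_cong[OF this, of "\<lambda>x. z \<bullet> x"] show ?thesis
      using that A B by simp
  qed
  have i: "t i * (w \<bullet> (A *\<^sub>v v)) = s i * (w \<bullet> (B *\<^sub>v v))"
    using eigen[OF v w(1)] .
  have j: "t j * (w \<bullet> (A *\<^sub>v v)) = s j * (w \<bullet> (B *\<^sub>v v))"
    using eigen[OF w v(1)] symmetric_scalar_prod_commute[OF A A_sym v(1) w(1)]
      symmetric_scalar_prod_commute[OF B B_sym v(1) w(1)] by simp
  \<comment> \<open>Each unknown is isolated by eliminating the other, as in Cramer's rule.\<close>
  have "s i * (t j * (w \<bullet> (A *\<^sub>v v))) = s j * (t i * (w \<bullet> (A *\<^sub>v v)))"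
    unfolding i j by (simp only: mult.left_commute)
  moreover have "t j * (s i * (w \<bullet> (B *\<^sub>v v))) = t i * (s j * (w \<bullet> (B *\<^sub>v v)))"
    unfolding i[symmetric] j[symmetric] by (simp only: mult.left_commute)
  ultimately have "(s i * t j - s j * t i) * (w \<bullet> (A *\<^sub>v v)) = 0"
    and "(s i * t j - s j * t i) * (w \<bullet> (B *\<^sub>v v)) = 0"
    by (simp_all add: algebra_simps)
  then show "w \<bullet> (A *\<^sub>v v) = 0" "w \<bullet> (B *\<^sub>v v) = 0"
    using distinct_roots[OF ij] by auto
qed

section \<open>Existence of a diagonalization\<close>

lemma congruence_index:
  fixes M U :: "'a mat"
  assumes "M \<in> carrier_mat n n" "U \<in> carrier_mat n n" "i < n" "j < n"
  shows "(transpose_mat U * M * U) $$ (i, j) = col U i \<bullet> (M *\<^sub>v col U j)"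
proof -
  have "transpose_mat U * M * U = transpose_mat U * (M * U)"
    using assms by (intro assoc_mult_mat) auto
  then show ?thesis
    using assms by (simp add: mult_mat_vec_def)
qed

lemma kernel_matrix_diagonalizes:
  assumes U: "U \<in> mats_over L n"
    and ker: "\<And>j. j < n \<Longrightarrow> singular j *\<^sub>v col U j = 0\<^sub>v n"
    and nz: "\<And>j. j < n \<Longrightarrow> col U j \<noteq> 0\<^sub>v n"
  shows "diagonalizes_over L n A B U"
proof -
  have carrier: "U \<in> carrier_mat n n"
    using U by (simp add: mats_over_iff)
  have "(transpose_mat U * A * U) $$ (i, j) = 0" "(transpose_mat U * B * U) $$ (i, j) = 0"
    if "i < n" "j < n" "i \<noteq> j" for i j
    unfolding congruence_index[OF A carrier that(1,2)] congruence_index[OF B carrier that(1,2)]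
    using kernels_orthogonal[OF that(2,1) _ _ ker[OF that(2)] _ ker[OF that(1)]] that carrier
    by simp_all
  then show ?thesis
    using U carrier det_kernel_matrix_nonzero[OF carrier ker nz]
    by (auto simp: diagonalizes_over_def diagonal_mat_def invertible_mat_iff_det_nonzero[OF carrier])
qed

text \<open>A vanishing determinant supplies kernel vectors only over the ambient field; columns of
  adjugates replace them by vectors over \<open>L\<close>.\<close>

lemma diagonalization_exists:
  assumes L: "subfield L ring_of_type_algebra" and AB: "A \<in> mats_over L n" "B \<in> mats_over L n"
    and st: "\<And>j. j < n \<Longrightarrow> s j \<in> L" "\<And>j. j < n \<Longrightarrow> t j \<in> L"
  shows "\<exists>U. diagonalizes_over L n A B U"
proof -
  have "\<exists>u. u \<in> vecs_over L n \<and> u \<noteq> 0\<^sub>v n \<and> singular i *\<^sub>v u = 0\<^sub>v n" if i: "i < n" for i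
  proof -
    have over: "singular i \<in> mats_over L n"
      using AB st[OF i] subfield_ring_of_type_algebraD(4,6)[OF L] by (auto simp: mats_over_iff)
    obtain v where v: "v \<in> carrier_vec n" "v \<noteq> 0\<^sub>v n" "singular i *\<^sub>v v = 0\<^sub>v n"
      using singular_kernel_exists[OF i] by blast
    obtain c where c: "c \<noteq> 0"
      "\<forall>r<n. \<forall>j<n. adj_mat (singular i) $$ (r, j) = c * v $ r * v $ j"
      using adj_mat_of_kernel_line[OF pencil_carrier pencil_symmetric v kernel_line[OF i v]]
      by blast
    obtain k where k: "k < n" "v $ k \<noteq> 0"
      using v by (metis carrier_vecD eq_vecI index_zero_vec)
    \<comment> \<open>This column is \<open>c * v $ k\<close> times \<open>v\<close>, and the choice
      of \<open>k\<close> makes it nonzero.\<close>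
    define u where "u = col (adj_mat (singular i)) k"
    have "u = (c * v $ k) \<cdot>\<^sub>v v"
      using c k v adj_mat(1)[OF pencil_carrier, of "t i" "s i"] unfolding u_def
      by (intro eq_vecI) (auto simp: mult_ac)
    moreover from this have "u $ k \<noteq> 0"
      using c k v(1) by simp
    then have "u \<noteq> 0\<^sub>v n"
      using k by auto
    ultimately have "u \<noteq> 0\<^sub>v n" "singular i *\<^sub>v u = 0\<^sub>v n"
      using v(3) mult_mat_vec[OF pencil_carrier v(1)] by (auto intro!: eq_vecI)
    moreover have "u \<in> vecs_over L n"
      using adj_mat_in_subfield[OF L over] k unfolding u_def
      by (auto simp: mats_over_iff vecs_over_iff)
    ultimately show ?thesis
      by blast
  qed
  then obtain f where f: "\<And>j. j < n \<Longrightarrow> f j \<in> vecs_over L n"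
      "\<And>j. j < n \<Longrightarrow> f j \<noteq> 0\<^sub>v n" "\<And>j. j < n \<Longrightarrow> singular j *\<^sub>v f j = 0\<^sub>v n"
    by metis
  define U where "U = mat n n (\<lambda>(r, j). f j $ r)"
  have col: "col U j = f j" if "j < n" for j
    using f(1)[OF that] that by (intro eq_vecI) (auto simp: U_def vecs_over_iff)
  have "U \<in> mats_over L n"
    using f(1) by (auto simp: U_def mats_over_iff vecs_over_iff)
  then show ?thesis
    using kernel_matrix_diagonalizes[of U L] f by (auto simp: col)
qed

section \<open>Arbitrary diagonalizing matrices and uniqueness\<close>

lemma col_nonzero_of_diagonalizes:
  assumes "diagonalizes_over L n A B U" "j < n"
  shows "col U j \<noteq> 0\<^sub>v n"
proof
  assume 0: "col U j = 0\<^sub>v n"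
  have U: "U \<in> carrier_mat n n" "det U \<noteq> 0"
    using assms by (auto simp: diagonalizes_over_def mats_over_iff invertible_mat_iff_det_nonzero)
  have "U *\<^sub>v unit_vec n j = 0\<^sub>v n"
    using mult_mat_vec_single_support[OF U(1) unit_vec_carrier assms(2)] 0 assms(2) by simp
  moreover have "unit_vec n j \<noteq> (0\<^sub>v n :: 'a vec)"
    using assms(2) by (metis index_unit_vec(2) index_zero_vec(1) zero_neq_one)
  ultimately show False
    using det_0_iff_vec_prod_zero[OF U(1)] U(2) unit_vec_carrier by blast
qed

text \<open>Congruence by \<open>U\<close> turns \<open>singular i\<close> into a diagonal matrix of
  determinant zero. Some diagonal entry vanishes, hence an entire column, and cancelling
  \<open>transpose_mat U\<close> puts the matching column of \<open>U\<close> in the kernel.\<close>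

lemma diagonalizing_col_in_kernel:
  assumes diag: "diagonalizes_over L n A B U" and i: "i < n"
  shows "\<exists>j<n. singular i *\<^sub>v col U j = 0\<^sub>v n"
proof -
  have U: "U \<in> carrier_mat n n" "det U \<noteq> 0"
    using diag by (auto simp: diagonalizes_over_def mats_over_iff invertible_mat_iff_det_nonzero)
  define D where "D = transpose_mat U * singular i * U"
  have D: "D \<in> carrier_mat n n"
    using U unfolding D_def by (intro mult_carrier_mat[of _ n n]) auto
  have D_off: "D $$ (r, j) = 0" if rj: "r < n" "j < n" "r \<noteq> j" for r j
  proof -
    have "col U r \<bullet> (A *\<^sub>v col U j) = 0" "col U r \<bullet> (B *\<^sub>v col U j) = 0"
      using diag rj U A B congruence_index[OF A U(1) rj(1,2)] congruence_index[OF B U(1) rj(1,2)]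
      by (auto simp: diagonalizes_over_def diagonal_mat_def)
    then show ?thesis
      using rj U(1) A B unfolding D_def congruence_index[OF pencil_carrier U(1) rj(1,2)]
      by (simp add: pencil_mult_vec scalar_prod_minus_distrib[of _ n])
  qed
  have "det (singular i) = 0"
    using i by (auto simp: det_pencil intro!: bexI[of _ i])
  then have "det D = 0"
    using U by (simp add: D_def det_mult[of _ n])
  moreover have "det D = (\<Prod>j = 0..<n. D $$ (j, j))"
    using D D_off det_upper_triangular[of D n] by (auto simp: prod_list_diag_prod upper_triangular_def)
  ultimately obtain j where j: "j < n" "D $$ (j, j) = 0"
    by auto
  have "transpose_mat U *\<^sub>v (singular i *\<^sub>v col U j) = 0\<^sub>v n"
  proof (rule eq_vecI)
    fix r assume "r < dim_vec (0\<^sub>v n :: 'a vec)"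
    then have r: "r < n" by simp
    then have "(transpose_mat U *\<^sub>v (singular i *\<^sub>v col U j)) $ r = D $$ (r, j)"
      unfolding D_def congruence_index[OF pencil_carrier U(1) r j(1)] using U by simp
    then show "(transpose_mat U *\<^sub>v (singular i *\<^sub>v col U j)) $ r = 0\<^sub>v n $ r"
      using D_off r j by (cases "r = j") auto
  qed (use U in auto)
  moreover have "det (transpose_mat U) \<noteq> 0"
    using U by (simp add: det_transpose)
  ultimately have "singular i *\<^sub>v col U j = 0\<^sub>v n"
    using det_0_iff_vec_prod_zero[of "transpose_mat U" n] U j
    by (metis col_carrier_vec carrier_matD(2) mult_mat_vec_carrier pencil_carrier transpose_carrier_mat)
  with j show ?thesis
    by blast
qed

text \<open>A column killed by two different singular members would be killed by the regular one and
  hence be zero. So choosing a column for each root is injective, and by finiteness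
  bijective.\<close>

lemma diagonalizing_cols_permutation:
  assumes diag: "diagonalizes_over L n A B U"
  shows "\<exists>\<sigma>. \<sigma> permutes {..<n} \<and> (\<forall>i<n. singular i *\<^sub>v col U (\<sigma> i) = 0\<^sub>v n)"
proof -
  have U: "U \<in> carrier_mat n n"
    using diag by (auto simp: diagonalizes_over_def mats_over_iff)
  obtain f where f: "\<And>i. i < n \<Longrightarrow> f i < n" "\<And>i. i < n \<Longrightarrow> singular i *\<^sub>v col U (f i) = 0\<^sub>v n"
    using diagonalizing_col_in_kernel[OF diag] by metis
  \<comment> \<open>\<open>permutes\<close> demands the identity outside
    \<open>{..<n}\<close>.\<close>
  define \<sigma> where "\<sigma> i = (if i < n then f i else i)" for i
  have "inj_on f {..<n}"
  proof (rule inj_onI, rule ccontr)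
    fix i j assume ij: "i \<in> {..<n}" "j \<in> {..<n}" "f i = f j" "i \<noteq> j"
    let ?u = "col U (f j)"
    have u: "?u \<in> carrier_vec n" "pencil x0 y0 *\<^sub>v ?u \<in> carrier_vec n"
      using U f(1)[of j] ij(2) by (simp_all add: mult_mat_vec_carrier[OF pencil_carrier])
    have "ratio i j \<cdot>\<^sub>v (pencil x0 y0 *\<^sub>v ?u) = 0\<^sub>v n"
      using singular_on_kernel[OF u(1) f(2)[of j], of i] f(2)[of i] ij by simp
    then have "pencil x0 y0 *\<^sub>v ?u = 0\<^sub>v n"
      using ratio_eq_0_iff[of i j] ij u by (auto simp: vec_eq_iff)
    then show False
      using regular_kernel[OF u(1)] col_nonzero_of_diagonalizes[OF diag f(1)] ij by auto
  qed
  then have "inj_on \<sigma> {..<n}"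
    by (simp add: inj_on_def \<sigma>_def)
  moreover have "\<sigma> ` {..<n} \<subseteq> {..<n}"
    using f(1) by (auto simp: \<sigma>_def)
  ultimately have "bij_betw \<sigma> {..<n} {..<n}"
    by (simp add: bij_betw_def endo_inj_surj)
  then have "\<sigma> permutes {..<n}"
    by (rule bij_imp_permutes) (simp add: \<sigma>_def)
  then show ?thesis
    using f(2) by (auto simp: \<sigma>_def)
qed

lemma col_in_vecs_over:
  assumes "diagonalizes_over L n A B U" "j < n"
  shows "col U j \<in> vecs_over L n"
  using assms by (auto simp: diagonalizes_over_def mats_over_iff vecs_over_iff)

text \<open>Each root labels one column of \<open>U\<close> and one of \<open>V\<close>, and both
  span the same kernel. The permutation goes from a column of \<open>U\<close> to its root and on to
  the column of \<open>V\<close>.\<close>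

lemma diagonalization_unique:
  assumes L: "subfield L ring_of_type_algebra"
    and U: "diagonalizes_over L n A B U" and V: "diagonalizes_over L n A B V"
  shows "same_columns_upto_perm_scale L n U V"
proof -
  obtain \<sigma> where \<sigma>: "\<sigma> permutes {..<n}" "\<And>i. i < n \<Longrightarrow> singular i *\<^sub>v col U (\<sigma> i) = 0\<^sub>v n"
    using diagonalizing_cols_permutation[OF U] by blast
  obtain \<tau> where \<tau>: "\<tau> permutes {..<n}" "\<And>i. i < n \<Longrightarrow> singular i *\<^sub>v col V (\<tau> i) = 0\<^sub>v n"
    using diagonalizing_cols_permutation[OF V] by blast
  have "\<exists>d\<in>L. d \<noteq> 0 \<and> col V ((\<tau> \<circ> inv_into UNIV \<sigma>) j) = d \<cdot>\<^sub>v col U j" if j: "j < n" for j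
  proof -
    define i where "i = inv_into UNIV \<sigma> j"
    have i: "i < n" "\<sigma> i = j" "\<tau> i < n"
      using j permutes_in_image[OF permutes_inv[OF \<sigma>(1)], of j] permutes_in_image[OF \<tau>(1), of i]
        permutes_inverses(1)[OF \<sigma>(1)] by (auto simp: i_def)
    have u: "col U j \<in> vecs_over L n" "col U j \<noteq> 0\<^sub>v n"
      and v: "col V (\<tau> i) \<in> vecs_over L n" "col V (\<tau> i) \<noteq> 0\<^sub>v n"
      using col_in_vecs_over col_nonzero_of_diagonalizes U V i(3) j by blast+
    obtain d where d: "col V (\<tau> i) = d \<cdot>\<^sub>v col U j"
      using kernel_line[OF i(1) _ u(2) _ _ \<tau>(2)[OF i(1)]] \<sigma>(2)[OF i(1)] u v i(2)
      by (auto simp: vecs_over_iff)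
    then have "d \<in> L"
      using smult_coeff_in_subfield[OF L u] v by simp
    moreover have "0 \<cdot>\<^sub>v w = 0\<^sub>v n" if "w \<in> carrier_vec n" for w :: "'a vec"
      using that by (intro eq_vecI) auto
    then have "d \<noteq> 0"
      using d v(2) u(1) by (auto simp: vecs_over_iff)
    ultimately show ?thesis
      using d by (auto simp: i_def)
  qed
  moreover have "\<tau> \<circ> inv_into UNIV \<sigma> permutes {..<n}"
    by (rule permutes_compose[OF permutes_inv[OF \<sigma>(1)] \<tau>(1)])
  ultimately show ?thesis
    unfolding same_columns_upto_perm_scale_def by blast
qed

end

text \<open>For \<open>n \<ge> 2\<close> pairwise non-proportionality forces every pair \<open>(s j, t j)\<close> to be nonzero.\<close>

lemma regular_point_exists:
  fixes s t :: "nat \<Rightarrow> 'a::field_char_0"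
  assumes n: "n \<ge> 2"
    and distinct: "\<And>i j. i < n \<Longrightarrow> j < n \<Longrightarrow> i \<noteq> j \<Longrightarrow> s i * t j \<noteq> s j * t i"
  shows "\<exists>y. \<forall>j<n. s j * 1 - t j * y \<noteq> 0"
proof -
  \<comment> \<open>With first coordinate 1, a factor with \<open>t j \<noteq> 0\<close> vanishes
    only at \<open>s j / t j\<close>. For \<open>t j = 0\<close> the default quotient 0 excludes one
    harmless extra value.\<close>
  obtain y where y: "y \<notin> (\<lambda>j. s j / t j) ` {..<n}"
    using ex_new_if_finite[OF infinite_UNIV_char_0, of "(\<lambda>j. s j / t j) ` {..<n}"] by auto
  have "s j * 1 - t j * y \<noteq> 0" if j: "j < n" for j
  proof (cases "t j = 0")
    case True
    \<comment> \<open>Here the factor is the constant \<open>s j\<close>; comparison with another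
      root gives \<open>s j * t k \<noteq> 0\<close>.\<close>
    obtain k where "k < n" "k \<noteq> j"
      using n by (metis One_nat_def Suc_1 Suc_le_lessD less_le_trans zero_less_Suc zero_neq_one)
    then show ?thesis
      using distinct[OF j, of k] True by auto
  next
    case False
    have "y \<noteq> s j / t j"
      using y j by auto
    then show ?thesis
      using False by (auto simp: field_simps)
  qed
  then show ?thesis
    by blast
qed

theorem theorem1p5:
  fixes n :: nat and K L :: "'a::field_char_0 set" and A B :: "'a mat" and s t :: "nat \<Rightarrow> 'a"
  assumes "n \<ge> 3"
    and "subfield K ring_of_type_algebra"
    and "A \<in> mats_over K n" and "symmetric_matrix A"
    and "B \<in> mats_over K n" and "symmetric_matrix B"
    and "is_splitting_field n (pair_form A B) K L"
    and "\<forall>j<n. s j \<in> L \<and> t j \<in> L"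
    and "linear_factorization n (pair_form A B) s t"
    and distinct_roots: "\<forall>i<n. \<forall>j<n. i \<noteq> j \<longrightarrow> s i * t j \<noteq> s j * t i"
  shows "(\<exists>U. diagonalizes_over L n A B U) \<and>
    (\<forall>U V. diagonalizes_over L n A B U \<and> diagonalizes_over L n A B V
       \<longrightarrow> same_columns_upto_perm_scale L n U V) \<and>
    (\<forall>U. diagonalizes_over L n A B U \<longrightarrow>
       (\<exists>\<sigma>. \<sigma> permutes {..<n} \<and>
          (\<forall>i<n. determines_linear_form L n
             (adj_mat (t i \<cdot>\<^sub>m A - s i \<cdot>\<^sub>m B)) (col U (\<sigma> i)))))"
proof -
  have L: "subfield L ring_of_type_algebra" and "K \<subseteq> L"
    using assms(7) by (auto simp: is_splitting_field_def)
  then have AB: "A \<in> mats_over L n" "B \<in> mats_over L n"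
    using assms(3,5) by (auto simp: mats_over_iff)
  have distinct: "\<And>i j. i < n \<Longrightarrow> j < n \<Longrightarrow> i \<noteq> j \<Longrightarrow> s i * t j \<noteq> s j * t i"
    using distinct_roots by blast
  obtain y0 where "\<And>j. j < n \<Longrightarrow> s j * 1 - t j * y0 \<noteq> 0"
    using regular_point_exists[OF _ distinct] assms(1) by force
  then interpret symmetric_pencil n A B s t 1 y0
    using assms(4,6,9) AB distinct by unfold_locales (auto simp: mats_over_iff)
  \<comment> \<open>Matched to its root \<open>i\<close>, a column of \<open>U\<close> spans the
    kernel of \<open>singular i\<close>, so the adjugate determines it.\<close>
  have "\<exists>\<sigma>. \<sigma> permutes {..<n} \<and>
      (\<forall>i<n. determines_linear_form L n (adj_mat (singular i)) (col U (\<sigma> i)))"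
    if U: "diagonalizes_over L n A B U" for U
  proof -
    obtain \<sigma> where \<sigma>: "\<sigma> permutes {..<n}" "\<And>i. i < n \<Longrightarrow> singular i *\<^sub>v col U (\<sigma> i) = 0\<^sub>v n"
      using diagonalizing_cols_permutation[OF U] by blast
    have "determines_linear_form L n (adj_mat (singular i)) (col U (\<sigma> i))" if i: "i < n" for i
    proof -
      have "\<sigma> i < n"
        using permutes_in_image[OF \<sigma>(1), of i] i by simp
      then have u: "col U (\<sigma> i) \<in> vecs_over L n" "col U (\<sigma> i) \<noteq> 0\<^sub>v n"
        using col_in_vecs_over[OF U] col_nonzero_of_diagonalizes[OF U] by blast+
      have over: "singular i \<in> mats_over L n"
        using AB assms(8) i subfield_ring_of_type_algebraD(4,6)[OF L] by (auto simp: mats_over_iff)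
      have "col U (\<sigma> i) \<in> carrier_vec n"
        using u by (simp add: vecs_over_iff)
      from kernel_line[OF i this u(2) \<sigma>(2)[OF i]] show ?thesis
        by (rule adj_mat_determines_kernel_line[OF L over pencil_symmetric u \<sigma>(2)[OF i]])
    qed
    with \<sigma>(1) show ?thesis
      by blast
  qed
  then show ?thesis
    using diagonalization_exists[OF L AB] diagonalization_unique[OF L] assms(8) by blast
qed

end
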